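(* Let $\beta=1+\epsilon+iR$ with $\pi<R<\infty$ and $$1+\epsilon=\frac{R}{2\pi}\log\left(\frac{1+\frac{\pi}{R}}{1-\frac{\pi}{R}}\right).$$ Then there is a constant $\widetilde A_\beta$ (depending only on $\beta$) such that, as $N\to\infty$, $$|Z_{\beta,N}|=Z_{\operatorname{Re}\beta,N}\,\widetilde A_\beta\,(1+o(1)),\qquad\text{and}\qquad \lim_{N\to\infty}\frac1N\log|Z_{\beta,N}|>0 .$$
   Context: For an integer $N\ge1$ and $\beta\in\mathbb{C}$, the Curie–Weiss partition function is $$Z_{\beta,N}=\frac1{2^N}\sum_{\sigma\in\{-1,+1\}^N}\exp(-\beta H_N(\sigma)),\qquad H_N(\sigma)=-\frac1{2N}\sum_{i,j=1}^N\sigma_i\sigma_j .$$ The notation $o(1)$ denotes a quantity tending to $0$ as $N\to\infty$ for fixed $\beta$. *)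

theory Defs
  imports Complex_Main "HOL-Library.FuncSet"
begin

text \<open>
  A spin configuration is an extensional function on \<open>{1..N}\<close>, so that each element of
  \<open>{-1,+1}\<close> to the power \<open>N\<close> is counted exactly once.
\<close>

definition spin_configs :: "nat \<Rightarrow> (nat \<Rightarrow> real) set" where
  "spin_configs N = {1..N} \<rightarrow>\<^sub>E {-1, 1}"

definition cw_energy :: "nat \<Rightarrow> (nat \<Rightarrow> real) \<Rightarrow> real" where
  "cw_energy N \<sigma> = - (1 / (2 * real N)) * (\<Sum>i\<in>{1..N}. \<Sum>j\<in>{1..N}. \<sigma> i * \<sigma> j)"

definition cw_Z :: "complex \<Rightarrow> nat \<Rightarrow> complex" where
  "cw_Z \<beta> N = (1 / 2 ^ N) * (\<Sum>\<sigma>\<in>spin_configs N. exp (- \<beta> * complex_of_real (cw_energy N \<sigma>)))"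

end

theory Submission
  imports Defs "HOL-Probability.Probability" "HOL-Real_Asymp.Real_Asymp"
begin

text \<open>
  Put \<open>b = Re \<beta>\<close> and \<open>m = \<pi> / R\<close>. The relation between \<open>1 + \<epsilon>\<close> and \<open>R\<close> says exactly that
  \<open>tanh (b m) = m\<close>: the spontaneous magnetization \<open>m\<close> at inverse temperature \<open>b\<close> satisfies
  \<open>Im \<beta> * m = \<pi>\<close>. The total spin \<open>S\<close> moves in steps of \<open>2\<close>, and near \<open>S = N m\<close> each step turns the
  phase \<open>exp (\<i> R S^2 / (2 N))\<close> by about \<open>2 R m = 2 \<pi>\<close>. Hence the weights of the dominant
  configurations do not cancel, and \<open>Z\<close> loses only a constant factor.

  Linearizing the square of the total spin by a Gaussian integral whose path is the line
  \<open>\<beta> \<real>\<close> (\<open>gaussian_linearization\<close>, \<open>cw_Z_integral\<close>) gives, for \<open>N \<ge> 1\<close>,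
  \<open>I(\<beta>) / sqrt N * Z = \<integral> (exp (- \<beta> z^2 / 2) * cosh (\<beta> z))^N dz\<close> with
  \<open>I(\<alpha>) = \<integral> exp (- \<alpha> u^2 / 2) du\<close>. Since \<open>\<bar>cosh (\<beta> z)\<bar> \<le> cosh (b z)\<close>, the integrand
  is bounded by its counterpart for \<open>b\<close>, whose modulus is maximal exactly at \<open>z = m\<close> and \<open>z = - m\<close>.
  Because \<open>sin (Im \<beta> * m) = 0\<close>, the bound is attained there, so that both points are saddle points and
  no deformation of the path is needed.

  The integrand is even; on \<open>z > 0\<close> substitute \<open>z = m + y / sqrt N\<close>. A concavity argument for
  \<open>tanh (b z) - z\<close> dominates the rescaled integrand by \<open>exp (- \<delta> y^2)\<close> (\<open>cosh_gaussian_bound\<close>), and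
  an expansion at \<open>z = m\<close> (\<open>cosh_sinh_gaussian_expansion\<close>) gives its pointwise limit
  \<open>exp (- \<gamma> y^2 / 2)\<close>, where \<open>\<gamma> = \<beta> (1 - \<beta> (1 - m^2))\<close>. Dominated convergence yields
  \<open>\<bar>Z\<bar> / \<rho>^N \<longlonglongrightarrow> 2 \<bar>I(\<gamma>)\<bar> / \<bar>I(\<beta>)\<bar>\<close> with \<open>\<rho> = exp (- b m^2 / 2) * cosh (b m) > 1\<close>
  (\<open>cw_Z_asymptotics\<close>). The same result applies to \<open>b\<close> in place of \<open>\<beta>\<close>, with the same \<open>\<rho>\<close>. The
  quotient of the two limits is the constant of the theorem; it is positive because \<open>I\<close> has no zeros in
  the right half plane (\<open>gauss_int_nonzero\<close>). The exponential growth rate is \<open>ln \<rho>\<close>.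
\<close>

section \<open>Complex Gaussian integrals\<close>

text \<open>
  The Gaussian integral with complex parameter \<open>\<alpha>\<close>; it converges for \<open>Re \<alpha> > 0\<close>. Its value, a
  square root of \<open>2 \<pi> / \<alpha>\<close>, is never needed, only that it does not vanish.
\<close>

definition gauss_int :: "complex \<Rightarrow> complex" where
  "gauss_int \<alpha> = (LBINT u. exp (- \<alpha> * complex_of_real (u\<^sup>2 / 2)))"

lemma integrable_gaussian_real:
  fixes a :: real
  assumes "a > 0"
  shows "integrable lborel (\<lambda>u. exp (- a * (u\<^sup>2 / 2)))"
    and "0 < (LBINT u. exp (- a * (u\<^sup>2 / 2)))"
proof -
  have eq: "exp (- a * (u\<^sup>2 / 2)) = sqrt (2 * pi / a) * normal_density 0 (1 / sqrt a) u" for u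
    using assms by (simp add: normal_density_def power_divide real_sqrt_divide real_sqrt_mult)
  show "integrable lborel (\<lambda>u. exp (- a * (u\<^sup>2 / 2)))"
    unfolding eq using assms by (intro integrable_mult_right integrable_normal_density) simp
  show "0 < (LBINT u. exp (- a * (u\<^sup>2 / 2)))"
    unfolding eq using assms by simp
qed

lemma integrable_gaussian:
  assumes "Re \<alpha> > 0"
  shows "integrable lborel (\<lambda>u. exp (- \<alpha> * complex_of_real (u\<^sup>2 / 2)))"
  by (rule Bochner_Integration.integrable_bound[OF integrable_gaussian_real(1)[OF assms]]) auto

text \<open>
  The Fourier transform of a Gaussian is a positive Gaussian, or a positive constant if \<open>c = 0\<close>.
\<close>

lemma gaussian_fourier:
  fixes a c :: real
  assumes "a > 0"
  shows "\<exists>r>0. \<exists>d\<ge>0. \<forall>s. (LBINT u. exp (- complex_of_real a * of_real (u\<^sup>2)) * exp (\<i> * of_real (c * s * u)))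
     = complex_of_real (r * exp (- d * (s\<^sup>2 / 2)))"
proof (rule exI[of _ "sqrt (pi / a)"], rule conjI, use assms in simp,
    rule exI[of _ "c\<^sup>2 / (2 * a)"], intro conjI allI)
  fix s :: real
  let ?f = "\<lambda>u::real. exp (- complex_of_real a * of_real (u\<^sup>2)) * exp (\<i> * of_real (c * s * u))"
  define k where "k = 1 / sqrt (2 * a)"
  have k: "k > 0" "a * k\<^sup>2 = 1 / 2" using assms by (auto simp: k_def power_divide)
  have "(LBINT u. ?f u) = \<bar>k\<bar> *\<^sub>R (LBINT u. ?f (0 + k * u))"
    using k by (intro lborel_integral_real_affine) auto
  also have "(LBINT u. ?f (0 + k * u)) = (LBINT u. complex_of_real (sqrt (2 * pi)) *
       (std_normal_density u *\<^sub>R iexp ((c * s * k) * u)))"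
  proof (intro Bochner_Integration.integral_cong refl)
    fix u :: real
    have "- complex_of_real a * of_real ((0 + k * u)\<^sup>2) = of_real (- u\<^sup>2 / 2)"
      using arg_cong[OF k(2), of "\<lambda>x. complex_of_real (- x * u\<^sup>2)"]
      by (simp add: power_mult_distrib mult.assoc)
    thus "?f (0 + k * u) = complex_of_real (sqrt (2 * pi)) *
       (std_normal_density u *\<^sub>R iexp ((c * s * k) * u))"
      by (simp only: std_normal_density_def exp_of_real) (simp add: scaleR_conv_of_real mult_ac)
  qed
  also have "\<dots> = complex_of_real (sqrt (2 * pi)) * char std_normal_distribution (c * s * k)"
    unfolding char_def by (subst integral_density) (auto simp flip: integral_mult_right_zero)
  also have "\<bar>k\<bar> *\<^sub>R \<dots> = complex_of_real (k * sqrt (2 * pi) * exp (- (c * s * k)\<^sup>2 / 2))"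
    using k by (simp add: char_std_normal_distribution scaleR_conv_of_real)
  also have "k * sqrt (2 * pi) = sqrt (pi / a)"
    using assms by (simp add: k_def real_sqrt_mult real_sqrt_divide)
  also have "- (c * s * k)\<^sup>2 / 2 = - (c\<^sup>2 / (2 * a)) * (s\<^sup>2 / 2)"
    using assms by (simp add: k_def power_mult_distrib power_divide)
  finally show "(LBINT u. ?f u) = complex_of_real (sqrt (pi / a) * exp (- (c\<^sup>2 / (2 * a)) * (s\<^sup>2 / 2)))"
    by simp
qed (use assms in auto)

text \<open>
  With \<open>f u = exp (- \<alpha> u^2 / 2)\<close>, the squared modulus of the integral of \<open>f\<close> is, by Fubini and the two
  shears \<open>x = y + s\<close> and \<open>y = u - s / 2\<close>, the integral over \<open>s\<close> of the integral over \<open>u\<close> of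
  \<open>f (u + s / 2) * cnj (f (u - s / 2))\<close>. There the imaginary part of \<open>\<alpha>\<close> survives only in the bilinear
  phase \<open>exp (- \<i> Im \<alpha> u s)\<close>, so that the inner integral is the Fourier transform of a Gaussian and
  therefore positive.
\<close>

lemma gauss_int_nonzero:
  assumes "Re \<alpha> > 0"
  shows "gauss_int \<alpha> \<noteq> 0"
proof -
  define f where "f = (\<lambda>u::real. exp (- \<alpha> * complex_of_real (u\<^sup>2 / 2)))"
  define a c where "a = Re \<alpha>" and "c = - Im \<alpha>"
  have alpha: "\<alpha> = of_real a - \<i> * of_real c" by (simp add: a_def c_def complex_eq_iff)
  have a: "a > 0" using assms by (simp add: a_def)
  have f_int: "integrable lborel f" unfolding f_def by (rule integrable_gaussian[OF assms])
  have f_meas [measurable]: "f \<in> borel_measurable borel" using f_int by simp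
  have [measurable]: "(\<lambda>u. cnj (f u)) \<in> borel_measurable borel"
    unfolding f_def by (intro borel_measurable_continuous_onI continuous_intros) auto
  have shift: "integrable lborel (\<lambda>s. f (s + y))" "(LBINT s. f (s + y)) = (LBINT s. f s)" for y
    using lborel_integrable_real_affine_iff[of 1 f y] lborel_integral_real_affine[of 1 f y] f_int
    by (simp_all add: add.commute)
  have shiftn: "(LBINT s. norm (f (s + y))) = (LBINT s. norm (f s))" for y
    using lborel_integral_real_affine[of 1 "\<lambda>s. norm (f s)" y] by (simp add: add.commute)
  have "integrable (lborel \<Otimes>\<^sub>M lborel) (\<lambda>(y, s). f (s + y) * cnj (f y))"
  proof (rule lborel_pair.Fubini_integrable)
    show "integrable lborel (\<lambda>x. LBINT y. norm (case (x, y) of (y, s) \<Rightarrow> f (s + y) * cnj (f y)))"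
      using f_int by (simp add: norm_mult shiftn)
    show "AE x in lborel. integrable lborel (\<lambda>y. case (x, y) of (y, s) \<Rightarrow> f (s + y) * cnj (f y))"
      using shift by simp
  qed measurable
  from lborel_pair.Fubini_integral[OF this]
  have fub: "(LBINT s. LBINT y. f (s + y) * cnj (f y)) = (LBINT y. LBINT s. f (s + y) * cnj (f y))" .
  have "gauss_int \<alpha> * cnj (gauss_int \<alpha>) = (LBINT y. LBINT s. f (s + y) * cnj (f y))"
    using f_int unfolding gauss_int_def f_def[symmetric] by (simp add: shift)
  also have "\<dots> = (LBINT s. LBINT y. f (s + y) * cnj (f y))" by (rule fub[symmetric])
  finally have eq: "gauss_int \<alpha> * cnj (gauss_int \<alpha>) = (LBINT s. LBINT y. f (s + y) * cnj (f y))" .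
  obtain r d where rd: "r > 0" "d \<ge> 0" and four:
     "\<And>s. (LBINT u. exp (- complex_of_real a * of_real (u\<^sup>2)) * exp (\<i> * of_real (c * s * u)))
     = complex_of_real (r * exp (- d * (s\<^sup>2 / 2)))"
    using gaussian_fourier[OF a, of c] by blast
  have inner: "(LBINT y. f (s + y) * cnj (f y)) = of_real (r * exp (- (a / 2 + d) * (s\<^sup>2 / 2)))" for s
  proof -
    have "(LBINT y. f (s + y) * cnj (f y)) = (LBINT u. f (u + s / 2) * cnj (f (u - s / 2)))"
      using lborel_integral_real_affine[of 1 "\<lambda>y. f (s + y) * cnj (f y)" "- s / 2"]
      by (simp add: add.commute)
    also have "(\<lambda>u. f (u + s / 2) * cnj (f (u - s / 2))) = (\<lambda>u. of_real (exp (- a / 2 * (s\<^sup>2 / 2))) *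
        (exp (- complex_of_real a * of_real (u\<^sup>2)) * exp (\<i> * of_real (c * s * u))))"
      unfolding f_def exp_cnj exp_of_real[symmetric] exp_add[symmetric]
      by (intro ext arg_cong[of _ _ exp]) (simp add: alpha complex_eq_iff power2_eq_square field_simps)
    also have "(LBINT u. of_real (exp (- a / 2 * (s\<^sup>2 / 2))) *
        (exp (- complex_of_real a * of_real (u\<^sup>2)) * exp (\<i> * of_real (c * s * u)))) =
        of_real (exp (- a / 2 * (s\<^sup>2 / 2)) * (r * exp (- d * (s\<^sup>2 / 2))))"
      by (simp only: integral_mult_right_zero four) simp
    also have "exp (- a / 2 * (s\<^sup>2 / 2)) * (r * exp (- d * (s\<^sup>2 / 2))) = r * exp (- (a / 2 + d) * (s\<^sup>2 / 2))"
      by (simp add: exp_add[symmetric] algebra_simps)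
    finally show ?thesis .
  qed
  have "(LBINT s. r * exp (- (a / 2 + d) * (s\<^sup>2 / 2))) > 0"
    using integrable_gaussian_real(2)[of "a / 2 + d"] a rd by simp
  hence "gauss_int \<alpha> * cnj (gauss_int \<alpha>) \<noteq> 0"
    unfolding eq inner integral_complex_of_real by (metis less_irrefl of_real_eq_0_iff)
  thus ?thesis by auto
qed

section \<open>Domination by a Gaussian around the mean-field solution\<close>

text \<open>
  The function \<open>tanh (b z) - z\<close> is concave on \<open>z \<ge> 0\<close> with zeros \<open>0\<close> and \<open>m\<close>. The secant through its
  points at \<open>m / 2\<close> and \<open>m\<close> has slope \<open>- c < 0\<close>; it lies below the function between these points and
  above it to the right of \<open>m\<close>.
\<close>

lemma tanh_minus_id_bounds:
  fixes b m :: real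
  assumes b: "b > 0" and m: "m > 0" and fp: "tanh (b * m) = m"
  shows "\<exists>c>0. (\<forall>z\<in>{0..m}. tanh (b * z) - z \<ge> 0) \<and>
               (\<forall>z\<in>{m/2..m}. tanh (b * z) - z \<ge> c * (m - z)) \<and>
               (\<forall>z\<ge>m. tanh (b * z) - z \<le> - c * (z - m))"
proof -
  define g where "g = (\<lambda>z. tanh (b * z) - z)"
  have conc: "concave_on {0..} g"
  proof (rule f''_le0_imp_concave)
    show "(g has_real_derivative b * (1 - tanh (b * x) ^ 2) - 1) (at x)" for x
      unfolding g_def by (auto intro!: derivative_eq_intros)
    show "((\<lambda>x. b * (1 - tanh (b * x) ^ 2) - 1) has_real_derivative
        - (2 * b\<^sup>2 * tanh (b * x) * (1 - tanh (b * x) ^ 2))) (at x)" for x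
      by (auto intro!: derivative_eq_intros simp: power2_eq_square algebra_simps)
    fix x :: real assume "x \<in> {0..}"
    hence "tanh (b * x) \<ge> 0" "tanh (b * x) ^ 2 \<le> 1"
      using b tanh_real_bounds[of "b * x"] by (auto simp: abs_square_le_1)
    thus "- (2 * b\<^sup>2 * tanh (b * x) * (1 - tanh (b * x) ^ 2)) \<le> 0"
      by simp
  qed auto
  have gm: "g m = 0" and g0: "g 0 = 0" by (simp_all add: g_def fp)
  \<comment> \<open>Positivity at \<open>m / 2\<close>, from the addition theorem for \<open>tanh\<close>.\<close>
  define t where "t = tanh (b * (m / 2))"
  have t: "t > 0" using b m by (simp add: t_def)
  have "m = 2 * t / (1 + t * t)"
    using tanh_add[of "b * (m / 2)" "b * (m / 2)"] fp by (simp add: t_def)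
  also have "\<dots> < 2 * t"
    using t by (simp add: pos_divide_less_eq add_pos_pos)
  finally have gh: "g (m / 2) > 0" by (simp add: g_def t_def)
  define c where "c = 2 * g (m / 2) / m"
  have c: "c > 0" using gh m by (simp add: c_def)
  have ghc: "g (m / 2) = c * m / 2" using m by (simp add: c_def)
  have 1: "g z \<ge> 0" if "z \<in> {0..m}" for z
    using concave_onD[OF conc, of "z / m" 0 m] that m by (simp add: gm g0)
  have 2: "g z \<ge> c * (m - z)" if "z \<in> {m/2..m}" for z
  proof -
    define s where "s = 2 * z / m - 1"
    have s: "0 \<le> s" "s \<le> 1" using that m by (auto simp: s_def field_simps)
    have e: "(1 - s) * (m / 2) + s * m = z" using m by (simp add: s_def field_simps)
    have h: "(1 - s) * (c * m / 2) = c * (m - z)"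
    proof -
      have "s * m = 2 * z - m" using m by (simp add: s_def field_simps)
      moreover have "(1 - s) * (c * m / 2) = c * (m - s * m) / 2" by (simp add: algebra_simps)
      ultimately have "(1 - s) * (c * m / 2) = c * (m - (2 * z - m)) / 2" by (simp only:)
      thus ?thesis by (simp add: field_simps)
    qed
    have "(1 - s) * g (m / 2) + s * g m \<le> g ((1 - s) * (m / 2) + s * m)"
      using concave_onD[OF conc s, of "m / 2" m] m by simp
    thus ?thesis unfolding e gm ghc h by simp
  qed
  have 3: "g z \<le> - c * (z - m)" if "z \<ge> m" for z
  proof -
    define s where "s = m / (2 * z - m)"
    have pos: "2 * z - m > 0" using that m by simp
    have s: "0 < s" "s \<le> 1" using that m pos by (auto simp: s_def field_simps)
    have sz: "s * (2 * z - m) = m" using pos by (simp add: s_def)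
    hence e: "(1 - s) * (m / 2) + s * z = m" by (simp add: field_simps)
    have "(1 - s) * g (m / 2) + s * g z \<le> g ((1 - s) * (m / 2) + s * z)"
      using concave_onD[OF conc, of s "m / 2" z] s m that by simp
    hence "(1 - s) * (c * m / 2) + s * g z \<le> 0" unfolding e gm ghc .
    moreover have "(1 - s) * (c * m / 2) = s * (c * (z - m))"
      using arg_cong[OF sz, of "(*) c"] by (simp add: field_simps)
    ultimately have "s * (c * (z - m) + g z) \<le> 0" by (simp add: algebra_simps)
    hence "c * (z - m) + g z \<le> 0" using s by (simp add: mult_le_0_iff)
    thus ?thesis by simp
  qed
  show ?thesis using c 1 2 3 unfolding g_def by blast
qed

text \<open>
  The slope of \<open>tanh (b z)\<close> at its positive fixed point is smaller than \<open>1\<close>.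
\<close>

lemma susceptibility_bound:
  fixes b m :: real
  assumes b: "b > 0" and m: "m > 0" and fp: "tanh (b * m) = m"
  shows "b * (1 - m\<^sup>2) < 1"
proof -
  have bm: "0 < b * m" using b m by simp
  obtain \<xi> where xi: "0 < \<xi>" "\<xi> < b * m" "tanh (b * m) - tanh 0 = (b * m - 0) * (1 - tanh \<xi> ^ 2)"
  proof -
    have "\<exists>z>0. z < b * m \<and> tanh (b * m) - tanh 0 = (b * m - 0) * (1 - tanh z ^ 2)"
      by (rule MVT2[OF bm]) (auto intro!: derivative_eq_intros)
    thus ?thesis using that by blast
  qed
  have "tanh \<xi> < m" "tanh \<xi> > 0" using xi fp by (metis tanh_real_less_iff) (use xi in auto)
  hence "tanh \<xi> ^ 2 < m ^ 2" by (intro power_strict_mono) auto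
  hence "b * m * (1 - m\<^sup>2) < b * m * (1 - tanh \<xi> ^ 2)"
    using bm by (intro mult_strict_left_mono) auto
  also have "\<dots> = m" using xi(3) fp by simp
  finally have "m * (b * (1 - m\<^sup>2)) < m * 1" by (simp add: mult_ac)
  thus ?thesis using m by simp
qed

text \<open>
  The function \<open>G z = ln (cosh (b z)) - b z^2 / 2\<close> satisfies \<open>G z - G m \<le> - \<delta> (z - m)^2\<close> for all
  \<open>z \<ge> 0\<close>. This is stated after exponentiation and in terms of \<open>w = z - m\<close>; its derivative is
  \<open>b (tanh (b z) - z)\<close>.
\<close>

lemma cosh_gaussian_bound:
  fixes b m :: real
  assumes b: "b > 0" and m: "m > 0" and fp: "tanh (b * m) = m"
  shows "\<exists>\<delta>>0. \<forall>w\<ge>-m. exp (- b * (m * w + w\<^sup>2 / 2)) * (cosh (b * (m + w)) / cosh (b * m))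
            \<le> exp (- \<delta> * w\<^sup>2)"
proof -
  from tanh_minus_id_bounds[OF assms] obtain c where c: "c > 0"
    and g0: "\<And>z. z \<in> {0..m} \<Longrightarrow> tanh (b * z) - z \<ge> 0"
    and g1: "\<And>z. z \<in> {m/2..m} \<Longrightarrow> tanh (b * z) - z \<ge> c * (m - z)"
    and g2: "\<And>z. z \<ge> m \<Longrightarrow> tanh (b * z) - z \<le> - c * (z - m)"
    by blast
  define K where "K = (\<lambda>w. ln (cosh (b * (m + w))) - ln (cosh (b * m)) - b * (m * w + w\<^sup>2 / 2))"
  define L where "L = (\<lambda>w. K w + b * c * w\<^sup>2 / 2)"
  have K0: "K 0 = 0" by (simp add: K_def)
  have dK: "(K has_real_derivative b * (tanh (b * (m + w)) - (m + w))) (at w)" for w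
    unfolding K_def by (auto intro!: derivative_eq_intros simp: tanh_def field_simps)
  have dL: "(L has_real_derivative b * (tanh (b * (m + w)) - (m + w) + c * w)) (at w)" for w
    unfolding L_def by (auto intro!: derivative_eq_intros dK simp: algebra_simps)
  have L_pos: "L w \<le> 0" if "w \<ge> 0" for w
  proof -
    have "L w \<le> L 0"
    proof (rule DERIV_nonpos_imp_nonincreasing[OF that])
      fix x :: real assume "0 \<le> x" "x \<le> w"
      thus "\<exists>y. (L has_real_derivative y) (at x) \<and> y \<le> 0"
        using dL[of x] g2[of "m + x"] b by (intro exI conjI) (auto simp: mult_le_0_iff)
    qed
    thus ?thesis by (simp add: L_def K0)
  qed
  have L_neg: "L w \<le> 0" if "w \<le> 0" "w \<ge> - m / 2" for w
  proof -
    have "L w \<le> L 0"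
    proof (rule DERIV_nonneg_imp_nondecreasing[OF that(1)])
      fix x :: real assume "w \<le> x" "x \<le> 0"
      thus "\<exists>y. (L has_real_derivative y) (at x) \<and> 0 \<le> y"
        using dL[of x] g1[of "m + x"] b that by (intro exI conjI) (auto simp: zero_le_mult_iff)
    qed
    thus ?thesis by (simp add: L_def K0)
  qed
  have K_bound: "K w \<le> - (b * c / 8) * w\<^sup>2" if "w \<ge> - m" for w
  proof (cases "w \<ge> - m / 2")
    case True
    hence "L w \<le> 0" using L_pos L_neg by (cases "w \<ge> 0") auto
    moreover have "b * c * w\<^sup>2 \<ge> 0" using b c by simp
    ultimately show ?thesis by (simp add: L_def)
  next
    case False
    \<comment> \<open>Here only monotonicity of \<open>K\<close> is available. The value at \<open>- m / 2\<close> is small enough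
      because \<open>w^2 \<le> m^2\<close>, which costs a factor \<open>4\<close> in the constant.\<close>
    have "K w \<le> K (- m / 2)"
    proof (rule DERIV_nonneg_imp_nondecreasing[where f = K])
      fix x :: real assume "w \<le> x" "x \<le> - m / 2"
      thus "\<exists>y. (K has_real_derivative y) (at x) \<and> 0 \<le> y"
        using dK[of x] g0[of "m + x"] b that m by (intro exI conjI) (auto simp: zero_le_mult_iff)
    qed (use False in auto)
    also have "\<dots> \<le> - (b * c / 8) * m\<^sup>2"
      using L_neg[of "- m / 2"] m by (simp add: L_def power2_eq_square)
    also have "w\<^sup>2 \<le> m\<^sup>2" using that False m by (simp add: abs_le_square_iff[symmetric])
    hence "- (b * c / 8) * m\<^sup>2 \<le> - (b * c / 8) * w\<^sup>2" using b c by simp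
    finally show ?thesis .
  qed
  have "exp (- b * (m * w + w\<^sup>2 / 2)) * (cosh (b * (m + w)) / cosh (b * m)) = exp (K w)" for w
    unfolding K_def exp_diff by (simp add: exp_minus divide_simps cosh_real_pos)
  thus ?thesis using K_bound b c by (intro exI[of _ "b * c / 8"]) auto
qed

section \<open>Integral representation of the partition function\<close>

text \<open>
  The Hubbard-Stratonovich transformation. Completing the square in the exponent
  \<open>- \<beta> N z^2 / 2 + \<beta> z S\<close> only shifts \<open>z\<close> by the real number \<open>S / N\<close>, although \<open>\<beta>\<close> is complex;
  hence no deformation of contours is needed.
\<close>

lemma gaussian_linearization:
  assumes beta: "Re \<beta> > 0" and N: "N > 0"
  shows "has_bochner_integral lborel
      (\<lambda>z. exp (- \<beta> * of_real (real N * (z\<^sup>2 / 2))) * exp (\<beta> * of_real (z * S)))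
      (gauss_int \<beta> / of_real (sqrt (real N)) * exp (\<beta> * of_real (S\<^sup>2 / (2 * real N))))"
proof -
  define f where "f = (\<lambda>u::real. exp (- \<beta> * complex_of_real (u\<^sup>2 / 2)))"
  define c where "c = sqrt (real N)"
  have c: "c > 0" "c\<^sup>2 = real N" using N by (auto simp: c_def)
  have "has_bochner_integral lborel f (gauss_int \<beta>)"
    unfolding gauss_int_def f_def using integrable_gaussian[OF beta] by (rule has_bochner_integral_integrable)
  hence "has_bochner_integral lborel (\<lambda>z. f (- S / c + c * z)) (gauss_int \<beta> /\<^sub>R \<bar>c\<bar>)"
    using c by (subst (asm) lborel_has_bochner_integral_real_affine_iff[of c _ _ "- S / c"]) auto
  hence "has_bochner_integral lborel (\<lambda>z. f (- S / c + c * z) * exp (\<beta> * of_real (S\<^sup>2 / (2 * real N))))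
     (gauss_int \<beta> /\<^sub>R \<bar>c\<bar> * exp (\<beta> * of_real (S\<^sup>2 / (2 * real N))))"
    by (intro has_bochner_integral_mult_left) auto
  moreover have "f (- S / c + c * z) * exp (\<beta> * of_real (S\<^sup>2 / (2 * real N)))
      = exp (- \<beta> * of_real (real N * (z\<^sup>2 / 2))) * exp (\<beta> * of_real (z * S))" for z
  proof -
    have "- ((- S / c + c * z)\<^sup>2 / 2) + S\<^sup>2 / (2 * real N) = - (real N * (z\<^sup>2 / 2)) + z * S"
      using c by (simp add: c(2)[symmetric] power2_eq_square field_simps)
    from arg_cong[OF this, of "\<lambda>x. \<beta> * of_real x"] show ?thesis
      unfolding f_def exp_add[symmetric] by (intro arg_cong[of _ _ exp]) (simp add: algebra_simps)
  qed
  moreover have "gauss_int \<beta> /\<^sub>R \<bar>c\<bar> = gauss_int \<beta> / of_real (sqrt (real N))"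
    using c by (simp add: c_def scaleR_conv_of_real divide_inverse mult.commute)
  ultimately show ?thesis by simp
qed

lemma cw_energy_eq: "cw_energy N \<sigma> = - ((\<Sum>i\<in>{1..N}. \<sigma> i)\<^sup>2 / (2 * real N))"
  unfolding cw_energy_def power2_eq_square sum_product by simp

lemma sum_spin_configs_exp:
  "(\<Sum>\<sigma>\<in>spin_configs N. exp (\<beta> * complex_of_real (z * (\<Sum>i\<in>{1..N}. \<sigma> i))))
     = (2 * cosh (\<beta> * of_real z)) ^ N"
proof -
  have "(\<Sum>\<sigma>\<in>spin_configs N. exp (\<beta> * complex_of_real (z * (\<Sum>i\<in>{1..N}. \<sigma> i))))
     = (\<Sum>\<sigma>\<in>spin_configs N. \<Prod>i\<in>{1..N}. exp (\<beta> * of_real z * of_real (\<sigma> i)))"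
    by (simp add: exp_sum[symmetric] sum_distrib_left mult.assoc)
  also have "\<dots> = (\<Prod>i\<in>{1..N}. \<Sum>y\<in>{-1, 1::real}. exp (\<beta> * of_real z * of_real y))"
    unfolding spin_configs_def by (rule prod_sum_PiE[symmetric]) auto
  also have "(\<Sum>y\<in>{-1, 1::real}. exp (\<beta> * of_real z * of_real y)) = 2 * cosh (\<beta> * of_real z)"
    by (simp add: cosh_field_def)
  finally show ?thesis by simp
qed

lemma cw_Z_integral:
  assumes beta: "Re \<beta> > 0" and N: "N > 0"
  shows "has_bochner_integral lborel
      (\<lambda>z. (exp (- \<beta> * of_real (z\<^sup>2 / 2)) * cosh (\<beta> * of_real z)) ^ N)
      (gauss_int \<beta> / of_real (sqrt (real N)) * cw_Z \<beta> N)"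
proof -
  have "has_bochner_integral lborel
      (\<lambda>z. 1 / 2 ^ N * (\<Sum>\<sigma>\<in>spin_configs N. exp (- \<beta> * of_real (real N * (z\<^sup>2 / 2))) *
              exp (\<beta> * of_real (z * (\<Sum>i\<in>{1..N}. \<sigma> i)))))
      (1 / 2 ^ N * (\<Sum>\<sigma>\<in>spin_configs N. gauss_int \<beta> / of_real (sqrt (real N)) *
              exp (\<beta> * of_real ((\<Sum>i\<in>{1..N}. \<sigma> i)\<^sup>2 / (2 * real N)))))"
    by (intro has_bochner_integral_mult_right has_bochner_integral_sum gaussian_linearization assms)
  also have "(\<lambda>z. 1 / 2 ^ N * (\<Sum>\<sigma>\<in>spin_configs N. exp (- \<beta> * of_real (real N * (z\<^sup>2 / 2))) *
              exp (\<beta> * of_real (z * (\<Sum>i\<in>{1..N}. \<sigma> i)))))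
     = (\<lambda>z. (exp (- \<beta> * of_real (z\<^sup>2 / 2)) * cosh (\<beta> * of_real z)) ^ N)"
    unfolding sum_distrib_left[symmetric] sum_spin_configs_exp
    by (simp add: power_mult_distrib exp_of_nat_mult[symmetric] mult_ac)
  also have "1 / 2 ^ N * (\<Sum>\<sigma>\<in>spin_configs N. gauss_int \<beta> / of_real (sqrt (real N)) *
              exp (\<beta> * of_real ((\<Sum>i\<in>{1..N}. \<sigma> i)\<^sup>2 / (2 * real N))))
     = gauss_int \<beta> / of_real (sqrt (real N)) * cw_Z \<beta> N"
    unfolding sum_distrib_left[symmetric] cw_Z_def cw_energy_eq by simp
  finally show ?thesis .
qed

lemma integral_even_function:
  fixes F :: "real \<Rightarrow> complex"
  assumes F: "integrable lborel F" and even: "\<And>z. F (- z) = F z"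
  shows "(LBINT z. F z) = 2 * (LBINT z. indicator {0<..} z *\<^sub>R F z)"
proof -
  have [measurable]: "F \<in> borel_measurable borel" using F by simp
  have i1: "integrable lborel (\<lambda>z. indicator {0<..} z *\<^sub>R F z)"
   and i2: "integrable lborel (\<lambda>z. indicator {..<0} z *\<^sub>R F z)"
    using F by (auto intro!: integrable_mult_indicator)
  have "(LBINT z. F z) = (LBINT z. indicator {0<..} z *\<^sub>R F z + indicator {..<0} z *\<^sub>R F z)"
  proof (rule integral_cong_AE)
    show "AE z in lborel. F z = indicator {0<..} z *\<^sub>R F z + indicator {..<0} z *\<^sub>R F z"
      using AE_lborel_singleton[of 0] by eventually_elim (auto simp: indicator_def)
  qed auto
  also have "\<dots> = (LBINT z. indicator {0<..} z *\<^sub>R F z) + (LBINT z. indicator {..<0} z *\<^sub>R F z)"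
    by (rule Bochner_Integration.integral_add[OF i1 i2])
  also have "(LBINT z. indicator {..<0} z *\<^sub>R F z) = (LBINT z. indicator {0<..} z *\<^sub>R F z)"
    by (subst lborel_integral_real_affine[of "-1" _ 0])
       (auto simp: even indicator_def intro!: Bochner_Integration.integral_cong)
  finally show ?thesis by simp
qed

section \<open>Local expansion at the saddle point\<close>

lemma exp_cubic_remainder:
  fixes x :: complex
  assumes "norm x \<le> K * w" "0 \<le> w" "w \<le> 1" "0 \<le> K"
  shows "norm (exp x - (1 + x + x\<^sup>2 / 2)) \<le> exp K * K ^ 3 * w ^ 3"
proof -
  have xK: "norm x \<le> K" using assms by (meson mult_left_le order_trans)
  have "norm (exp x - (1 + x + x\<^sup>2 / 2)) \<le> exp (norm x) * norm x ^ 3 / 2"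
    using Taylor_exp_field[of x 2] by (simp add: numeral_eq_Suc atMost_Suc algebra_simps)
  also have "\<dots> \<le> exp (norm x) * norm x ^ 3" by simp
  also have "\<dots> \<le> exp K * (K * w) ^ 3"
    using xK assms by (intro mult_mono power_mono) auto
  finally show ?thesis by (simp add: power_mult_distrib)
qed

text \<open>
  Writing the hyperbolic functions as exponentials turns the first function into the mixture
  \<open>p * exp x1 + q * exp x2\<close> with \<open>p = (1 + m) / 2\<close> and \<open>q = (1 - m) / 2\<close>, where \<open>x1\<close> and \<open>x2\<close> are
  \<open>\<beta>\<close> times quadratic polynomials in \<open>w\<close>. The linear terms cancel, and so do the cubic terms coming
  from the squares of \<open>x1\<close> and \<open>x2\<close>.
\<close>

lemma cosh_sinh_gaussian_expansion:
  fixes \<beta> :: complex and m :: real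
  assumes m: "0 < m" "m < 1"
  shows "\<exists>C. \<forall>w. \<bar>w\<bar> \<le> 1 \<longrightarrow>
     norm (exp (- \<beta> * of_real (m * w + w\<^sup>2 / 2)) * (cosh (\<beta> * of_real w) + of_real m * sinh (\<beta> * of_real w))
       - exp (- (\<beta> * (1 - \<beta> * of_real (1 - m\<^sup>2))) * of_real (w\<^sup>2 / 2))) \<le> C * \<bar>w\<bar> ^ 3"
proof -
  define \<kappa> where "\<kappa> = \<beta> * (1 - \<beta> * of_real (1 - m\<^sup>2))"
  define p q where "p = (1 + m) / 2" and "q = (1 - m) / 2"
  define K where "K = 3 * norm \<beta>"
  define E where "E = (\<lambda>x::complex. exp x - (1 + x + x\<^sup>2 / 2))"
  define C where "C = exp K * K ^ 3 + exp K * K ^ 3 + norm \<beta> ^ 2 / 8 + exp (norm \<kappa>) * norm \<kappa> ^ 3 + norm \<kappa> ^ 2 / 8"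
  show ?thesis
  proof (intro exI[of _ C] allI impI)
    fix w :: real assume w: "\<bar>w\<bar> \<le> 1"
    have w2: "w\<^sup>2 \<le> \<bar>w\<bar>" using w by (metis abs_ge_zero abs_mult_self_eq mult_left_le power2_eq_square)
    have w4: "w ^ 4 \<le> \<bar>w\<bar> ^ 3" using w power_decreasing[of 3 4 "\<bar>w\<bar>"] by simp
    define x1 x2 where "x1 = \<beta> * of_real ((1 - m) * w - w\<^sup>2 / 2)"
                   and "x2 = \<beta> * of_real (- (1 + m) * w - w\<^sup>2 / 2)"
    define x3 where "x3 = - \<kappa> * of_real (w\<^sup>2 / 2)"
    have 1: "exp (- \<beta> * of_real (m * w + w\<^sup>2 / 2)) * (cosh (\<beta> * of_real w) + of_real m * sinh (\<beta> * of_real w))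
       = p * exp x1 + q * exp x2"
    proof -
      have "x1 = - \<beta> * of_real (m * w + w\<^sup>2 / 2) + \<beta> * of_real w"
           "x2 = - \<beta> * of_real (m * w + w\<^sup>2 / 2) + - (\<beta> * of_real w)"
        by (simp_all add: x1_def x2_def algebra_simps)
      thus ?thesis
        by (simp only: exp_add) (simp add: cosh_field_def sinh_field_def p_def q_def field_simps)
    qed
    have 2: "p * (1 + x1 + x1\<^sup>2 / 2) + q * (1 + x2 + x2\<^sup>2 / 2) = 1 + x3 + \<beta>\<^sup>2 * of_real (w ^ 4 / 8)"
      by (simp add: x1_def x2_def x3_def \<kappa>_def p_def q_def field_simps power2_eq_square power4_eq_xxxx)
    have 3: "p * exp x1 + q * exp x2 - exp x3 = p * E x1 + q * E x2 + \<beta>\<^sup>2 * of_real (w ^ 4 / 8) - E x3 - x3\<^sup>2 / 2"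
      using 2 by (simp add: E_def algebra_simps)
    have E1: "norm (E x1) \<le> exp K * K ^ 3 * \<bar>w\<bar> ^ 3" unfolding E_def
    proof (rule exp_cubic_remainder)
      have "\<bar>(1 - m) * w - w\<^sup>2 / 2\<bar> \<le> \<bar>(1 - m) * w\<bar> + \<bar>w\<^sup>2 / 2\<bar>" by (rule abs_triangle_ineq4)
      also have "\<bar>(1 - m) * w\<bar> \<le> 2 * \<bar>w\<bar>" using m by (auto simp: abs_mult intro!: mult_right_mono)
      also have "\<bar>w\<^sup>2 / 2\<bar> \<le> \<bar>w\<bar>" using w2 by simp
      finally show "norm x1 \<le> K * \<bar>w\<bar>"
        unfolding x1_def norm_mult norm_of_real K_def
        using mult_left_mono[of "\<bar>(1 - m) * w - w\<^sup>2 / 2\<bar>" "3 * \<bar>w\<bar>" "norm \<beta>"] by (simp add: mult_ac)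
    qed (use w in \<open>auto simp: K_def\<close>)
    have E2: "norm (E x2) \<le> exp K * K ^ 3 * \<bar>w\<bar> ^ 3" unfolding E_def
    proof (rule exp_cubic_remainder)
      have "\<bar>- (1 + m) * w - w\<^sup>2 / 2\<bar> \<le> \<bar>- (1 + m) * w\<bar> + \<bar>w\<^sup>2 / 2\<bar>" by (rule abs_triangle_ineq4)
      also have "\<bar>- (1 + m) * w\<bar> \<le> 2 * \<bar>w\<bar>"
        unfolding abs_mult using m by (intro mult_right_mono) auto
      also have "\<bar>w\<^sup>2 / 2\<bar> \<le> \<bar>w\<bar>" using w2 by simp
      finally show "norm x2 \<le> K * \<bar>w\<bar>"
        unfolding x2_def norm_mult norm_of_real K_def
        using mult_left_mono[of "\<bar>- (1 + m) * w - w\<^sup>2 / 2\<bar>" "3 * \<bar>w\<bar>" "norm \<beta>"] by (simp add: mult_ac)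
    qed (use w in \<open>auto simp: K_def\<close>)
    have E3: "norm (E x3) \<le> exp (norm \<kappa>) * norm \<kappa> ^ 3 * \<bar>w\<bar> ^ 3" unfolding E_def
    proof (rule exp_cubic_remainder)
      have "w\<^sup>2 / 2 \<le> \<bar>w\<bar>" using w2 zero_le_power2[of w] by linarith
      thus "norm x3 \<le> norm \<kappa> * \<bar>w\<bar>" unfolding x3_def norm_mult norm_minus_cancel norm_of_real
        by (intro mult_left_mono) auto
    qed (use w in auto)
    have pE: "norm (p * E x1) \<le> exp K * K ^ 3 * \<bar>w\<bar> ^ 3"
      using mult_mono[OF _ E1, of p 1] m unfolding norm_mult norm_of_real by (simp add: p_def)
    have qE: "norm (q * E x2) \<le> exp K * K ^ 3 * \<bar>w\<bar> ^ 3"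
      using mult_mono[OF _ E2, of q 1] m unfolding norm_mult norm_of_real by (simp add: q_def)
    have b4: "norm (\<beta>\<^sup>2 * of_real (w ^ 4 / 8)) \<le> norm \<beta> ^ 2 / 8 * \<bar>w\<bar> ^ 3"
      using mult_left_mono[OF w4, of "norm \<beta> ^ 2 / 8"] by (simp add: norm_mult norm_power norm_divide)
    have x4: "norm (x3\<^sup>2 / 2) \<le> norm \<kappa> ^ 2 / 8 * \<bar>w\<bar> ^ 3"
      using mult_left_mono[OF w4, of "norm \<kappa> ^ 2 / 8"]
      by (simp add: x3_def norm_mult norm_power norm_divide power_mult_distrib power_divide)
    have "norm (p * exp x1 + q * exp x2 - exp x3) \<le>
        norm (p * E x1) + norm (q * E x2) + norm (\<beta>\<^sup>2 * of_real (w ^ 4 / 8)) + norm (E x3) + norm (x3\<^sup>2 / 2)"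
      unfolding 3
      by (intro order_trans[OF norm_triangle_ineq4] order_trans[OF norm_triangle_ineq] add_mono order_refl)
    also have "\<dots> \<le> C * \<bar>w\<bar> ^ 3"
      unfolding C_def distrib_right by (intro add_mono pE qE b4 E3 x4)
    finally show "norm (exp (- \<beta> * of_real (m * w + w\<^sup>2 / 2)) * (cosh (\<beta> * of_real w) + of_real m * sinh (\<beta> * of_real w))
       - exp (- (\<beta> * (1 - \<beta> * of_real (1 - m\<^sup>2))) * of_real (w\<^sup>2 / 2))) \<le> C * \<bar>w\<bar> ^ 3"
      unfolding 1 x3_def \<kappa>_def .
  qed
qed

lemma norm_cosh_le: "norm (cosh (z :: complex)) \<le> cosh (Re z)"
proof -
  have "norm (exp z + exp (- z)) \<le> exp (Re z) + exp (- Re z)"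
    using norm_triangle_ineq[of "exp z" "exp (- z)"] by simp
  thus ?thesis by (simp add: cosh_field_def norm_divide)
qed

text \<open>
  For \<open>w \<ge> - m\<close>, both \<open>\<Psi> w\<close> and the Gaussian \<open>g w = exp (- \<gamma> w^2 / 2)\<close> have modulus at most \<open>1\<close>, hence
  their \<open>N\<close>-th powers differ by at most \<open>N * \<bar>\<Psi> w - g w\<bar>\<close>. At \<open>w = y / sqrt N\<close> this product is
  \<open>O(1 / sqrt N)\<close>, and \<open>(g w)^N = g y\<close>. The index \<open>Suc n\<close> stands for \<open>N\<close> and avoids \<open>N = 0\<close>.
\<close>

lemma power_tendsto_gaussian:
  fixes \<gamma> :: complex and m y :: real and \<Psi> :: "real \<Rightarrow> complex"
  assumes bound: "\<And>w. w \<ge> -m \<Longrightarrow> norm (\<Psi> w) \<le> 1" and m: "m > 0"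
    and gam: "Re \<gamma> \<ge> 0"
    and cubic: "\<And>w. \<bar>w\<bar> \<le> 1 \<Longrightarrow> norm (\<Psi> w - exp (- \<gamma> * of_real (w\<^sup>2 / 2))) \<le> C * \<bar>w\<bar> ^ 3"
  shows "(\<lambda>n. \<Psi> (y / sqrt (real (Suc n))) ^ Suc n) \<longlonglongrightarrow> exp (- \<gamma> * of_real (y\<^sup>2 / 2))"
proof (rule LIM_zero_cancel, rule Lim_null_comparison)
  define w where "w = (\<lambda>n. y / sqrt (real (Suc n)))"
  have w0: "w \<longlonglongrightarrow> 0" unfolding w_def
    by real_asymp
  have e1: "eventually (\<lambda>n. \<bar>w n\<bar> < 1) sequentially"
    using tendsto_rabs_zero[OF w0] by (rule order_tendstoD) simp
  have e2: "eventually (\<lambda>n. w n > - m) sequentially"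
    using w0 by (rule order_tendstoD) (use m in simp)
  show "eventually (\<lambda>n. norm (\<Psi> (y / sqrt (real (Suc n))) ^ Suc n - exp (- \<gamma> * of_real (y\<^sup>2 / 2)))
      \<le> C * \<bar>y\<bar> ^ 3 / sqrt (real (Suc n))) sequentially"
    using e1 e2
  proof eventually_elim
    case (elim n)
    have "exp (- \<gamma> * of_real (y\<^sup>2 / 2)) = exp (- \<gamma> * of_real (w n ^ 2 / 2)) ^ Suc n"
    proof -
      have "y\<^sup>2 / 2 = real (Suc n) * (w n ^ 2 / 2)" by (simp add: w_def power_divide del: of_nat_Suc)
      hence "- \<gamma> * of_real (y\<^sup>2 / 2) = of_nat (Suc n) * (- \<gamma> * of_real (w n ^ 2 / 2))"
        by (simp only: of_real_mult of_real_of_nat_eq mult_ac)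
      thus ?thesis by (simp only: exp_of_nat_mult)
    qed
    hence "norm (\<Psi> (w n) ^ Suc n - exp (- \<gamma> * of_real (y\<^sup>2 / 2))) =
        norm (\<Psi> (w n) ^ Suc n - exp (- \<gamma> * of_real (w n ^ 2 / 2)) ^ Suc n)" by simp
    also have "\<dots> \<le> Suc n * norm (\<Psi> (w n) - exp (- \<gamma> * of_real (w n ^ 2 / 2)))"
      using elim bound gam by (intro norm_power_diff) auto
    also have "\<dots> \<le> Suc n * (C * \<bar>w n\<bar> ^ 3)"
      using elim cubic by (intro mult_left_mono) auto
    also have "\<dots> = C * \<bar>y\<bar> ^ 3 / sqrt (real (Suc n))"
    proof -
      have "\<bar>w n\<bar> ^ 3 = \<bar>y\<bar> ^ 3 / (real (Suc n) * sqrt (real (Suc n)))"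
        by (simp add: w_def power_divide power3_eq_cube)
      thus ?thesis by (simp del: of_nat_Suc)
    qed
    finally show ?case unfolding w_def .
  qed
  show "(\<lambda>n. C * \<bar>y\<bar> ^ 3 / sqrt (real (Suc n))) \<longlonglongrightarrow> 0" by real_asymp
qed

section \<open>Asymptotics of the partition function\<close>

text \<open>
  The limit of \<open>\<bar>Z\<bar> / \<rho>^N\<close> under the resonance condition \<open>sin (Im \<beta> * m) = 0\<close>, which also covers real
  \<open>\<beta>\<close>. In the proof, \<open>F z\<close> is the function whose \<open>N\<close>-th power is integrated, \<open>B = F m\<close> is its
  value at the saddle point, and \<open>\<Psi> w\<close> is the normalized function \<open>F (m + w) / F m\<close>. The second claim
  makes the limiting Gaussian integral convergent.
\<close>

lemma cw_Z_asymptotics: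
  fixes \<beta> :: complex and m :: real
  assumes b: "Re \<beta> > 0" and m: "0 < m" and fp: "tanh (Re \<beta> * m) = m"
    and res: "sin (Im \<beta> * m) = 0"
  shows "(\<lambda>N. norm (cw_Z \<beta> N) / (exp (- Re \<beta> * (m\<^sup>2 / 2)) * cosh (Re \<beta> * m)) ^ N)
     \<longlonglongrightarrow> 2 * norm (gauss_int (\<beta> * (1 - \<beta> * of_real (1 - m\<^sup>2)))) / norm (gauss_int \<beta>)"
    and "Re (\<beta> * (1 - \<beta> * of_real (1 - m\<^sup>2))) > 0"
proof -
  define \<gamma> where "\<gamma> = \<beta> * (1 - \<beta> * of_real (1 - m\<^sup>2))"
  define s where "s = cos (Im \<beta> * m)"
  define \<rho> where "\<rho> = exp (- Re \<beta> * (m\<^sup>2 / 2)) * cosh (Re \<beta> * m)"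
  define \<Psi> where "\<Psi> = (\<lambda>w. exp (- \<beta> * of_real (m * w + w\<^sup>2 / 2)) *
     (cosh (\<beta> * of_real (m + w)) / cosh (\<beta> * of_real m)))"
  define B where "B = exp (- \<beta> * of_real (m\<^sup>2 / 2)) * cosh (\<beta> * of_real m)"
  define F where "F = (\<lambda>z. exp (- \<beta> * of_real (z\<^sup>2 / 2)) * cosh (\<beta> * of_real z))"
  have m1: "m < 1" using tanh_real_lt_1[of "Re \<beta> * m"] fp by simp
  show Re_gam: "Re (\<beta> * (1 - \<beta> * of_real (1 - m\<^sup>2))) > 0"
  proof -
    have "Re (\<beta> * (1 - \<beta> * of_real (1 - m\<^sup>2))) = Re \<beta> * (1 - Re \<beta> * (1 - m\<^sup>2)) + (1 - m\<^sup>2) * (Im \<beta>)\<^sup>2"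
      by (simp add: algebra_simps power2_eq_square)
    also have "\<dots> > 0" using susceptibility_bound[OF b m fp] b m m1
      by (intro add_pos_nonneg mult_pos_pos mult_nonneg_nonneg) (auto simp: power_le_one)
    finally show ?thesis .
  qed
  \<comment> \<open>By the resonance condition, \<open>exp (\<beta> m)\<close> and \<open>exp (b m)\<close> agree up to the sign \<open>s\<close>, and so do
    the hyperbolic functions of \<open>\<beta> m\<close> and \<open>b m\<close>.\<close>
  have s2: "\<bar>s\<bar> = 1" unfolding s_def using res sin_zero_abs_cos_one by blast
  have expm: "exp (\<beta> * of_real m) = of_real (exp (Re \<beta> * m) * s)"
             "exp (- (\<beta> * of_real m)) = of_real (exp (- (Re \<beta> * m)) * s)"
    using res by (simp_all add: complex_eq_iff Re_exp Im_exp s_def)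
  have cosh_m: "cosh (\<beta> * of_real m) = of_real (cosh (Re \<beta> * m) * s)"
    and sinh_m: "sinh (\<beta> * of_real m) = of_real (sinh (Re \<beta> * m) * s)"
    unfolding cosh_field_def sinh_field_def expm by (simp_all add: field_simps)
  have cosh_nz: "cosh (\<beta> * of_real m) \<noteq> 0"
    unfolding cosh_m of_real_eq_0_iff using s2 by auto
  have norm_cosh_m: "norm (cosh (\<beta> * of_real m)) = cosh (Re \<beta> * m)"
    unfolding cosh_m norm_of_real abs_mult s2 by simp
  have sinh_cosh: "sinh (\<beta> * of_real m) = of_real m * cosh (\<beta> * of_real m)"
  proof -
    have "sinh (Re \<beta> * m) = m * cosh (Re \<beta> * m)" using fp by (simp add: tanh_def field_simps)
    thus ?thesis unfolding cosh_m sinh_m by simp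
  qed
  have norm_B: "norm B = \<rho>" unfolding B_def \<rho>_def norm_mult norm_cosh_m by simp
  have \<Psi>_eq: "\<Psi> w = exp (- \<beta> * of_real (m * w + w\<^sup>2 / 2)) *
      (cosh (\<beta> * of_real w) + of_real m * sinh (\<beta> * of_real w))" for w
    using cosh_nz unfolding \<Psi>_def of_real_add distrib_left cosh_add sinh_cosh by (simp add: field_simps)
  have F_\<Psi>: "F (m + w) = B * \<Psi> w" for w
  proof -
    have "exp (- \<beta> * of_real ((m + w)\<^sup>2 / 2)) =
        exp (- \<beta> * of_real (m\<^sup>2 / 2)) * exp (- \<beta> * of_real (m * w + w\<^sup>2 / 2))"
      unfolding exp_add[symmetric]
      by (intro arg_cong[of _ _ exp]) (simp add: power2_eq_square field_simps)
    thus ?thesis using cosh_nz by (simp add: F_def B_def \<Psi>_def)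
  qed
  obtain \<delta> where \<delta>: "\<delta> > 0" and dom: "\<And>w. w \<ge> -m \<Longrightarrow>
      exp (- Re \<beta> * (m * w + w\<^sup>2 / 2)) * (cosh (Re \<beta> * (m + w)) / cosh (Re \<beta> * m)) \<le> exp (- \<delta> * w\<^sup>2)"
    using cosh_gaussian_bound[OF b m fp] by blast
  have \<Psi>_bound: "norm (\<Psi> w) \<le> exp (- \<delta> * w\<^sup>2)" if "w \<ge> -m" for w
  proof -
    have "norm (\<Psi> w) = exp (- Re \<beta> * (m * w + w\<^sup>2 / 2)) *
        (norm (cosh (\<beta> * of_real (m + w))) / cosh (Re \<beta> * m))"
      unfolding \<Psi>_def norm_mult norm_divide norm_cosh_m by simp
    also have "\<dots> \<le> exp (- Re \<beta> * (m * w + w\<^sup>2 / 2)) * (cosh (Re \<beta> * (m + w)) / cosh (Re \<beta> * m))"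
      using norm_cosh_le[of "\<beta> * of_real (m + w)"]
      by (intro mult_left_mono divide_right_mono) auto
    also have "\<dots> \<le> exp (- \<delta> * w\<^sup>2)" by (rule dom[OF that])
    finally show ?thesis .
  qed
  define J where "J = (\<lambda>n y. indicator {0<..} (m + y / sqrt (real (Suc n))) *\<^sub>R
      \<Psi> (y / sqrt (real (Suc n))) ^ Suc n)"
  have Z_eq: "cw_Z \<beta> (Suc n) = 2 / gauss_int \<beta> * B ^ Suc n * (LBINT y. J n y)" for n
  proof -
    define c where "c = sqrt (real (Suc n))"
    have c: "c > 0" by (simp add: c_def)
    have "has_bochner_integral lborel (\<lambda>z. F z ^ Suc n) (gauss_int \<beta> / of_real c * cw_Z \<beta> (Suc n))"
      unfolding F_def c_def by (rule cw_Z_integral[OF b]) simp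
    hence int: "integrable lborel (\<lambda>z. F z ^ Suc n)"
      and "gauss_int \<beta> / of_real c * cw_Z \<beta> (Suc n) = (LBINT z. F z ^ Suc n)"
      by (auto simp: has_bochner_integral_iff)
    note this(2)
    also have "(LBINT z. F z ^ Suc n) = 2 * (LBINT z. indicator {0<..} z *\<^sub>R F z ^ Suc n)"
      by (rule integral_even_function[OF int]) (simp add: F_def)
    also have "(LBINT z. indicator {0<..} z *\<^sub>R F z ^ Suc n) =
        \<bar>1 / c\<bar> *\<^sub>R (LBINT y. indicator {0<..} (m + 1 / c * y) *\<^sub>R F (m + 1 / c * y) ^ Suc n)"
      using c by (intro lborel_integral_real_affine) auto
    also have "(\<lambda>y. indicator {0<..} (m + 1 / c * y) *\<^sub>R F (m + 1 / c * y) ^ Suc n) =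
        (\<lambda>y. B ^ Suc n * J n y)"
      unfolding F_\<Psi> J_def c_def by (simp add: power_mult_distrib mult_ac)
    finally show ?thesis
      using c gauss_int_nonzero[OF b] by (simp add: field_simps scaleR_conv_of_real)
  qed
  have \<Psi>_meas [measurable]: "\<Psi> \<in> borel_measurable borel"
    unfolding \<Psi>_def cosh_field_def using cosh_nz
    by (intro borel_measurable_continuous_onI continuous_intros) (auto simp: cosh_field_def)
  obtain C where cubic: "\<And>w. \<bar>w\<bar> \<le> 1 \<Longrightarrow>
      norm (\<Psi> w - exp (- \<gamma> * of_real (w\<^sup>2 / 2))) \<le> C * \<bar>w\<bar> ^ 3"
    using cosh_sinh_gaussian_expansion[OF m m1, of \<beta>] unfolding \<Psi>_eq \<gamma>_def by blast
  have J_lim: "(\<lambda>n. LBINT y. J n y) \<longlonglongrightarrow> gauss_int \<gamma>"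
    unfolding gauss_int_def
  proof (rule integral_dominated_convergence[where w = "\<lambda>y. exp (- (2 * \<delta>) * (y\<^sup>2 / 2))"])
    show "integrable lborel (\<lambda>y. exp (- (2 * \<delta>) * (y\<^sup>2 / 2)))"
      using \<delta> by (intro integrable_gaussian_real) auto
    show "AE y in lborel. (\<lambda>n. J n y) \<longlonglongrightarrow> exp (- \<gamma> * of_real (y\<^sup>2 / 2))"
    proof (rule AE_I2)
      fix y :: real
      have \<Psi>1: "norm (\<Psi> w) \<le> 1" if "w \<ge> -m" for w
        using \<Psi>_bound[OF that] \<delta> by (auto intro: order_trans)
      have lim: "(\<lambda>n. \<Psi> (y / sqrt (real (Suc n))) ^ Suc n) \<longlonglongrightarrow> exp (- \<gamma> * of_real (y\<^sup>2 / 2))"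
        using \<Psi>1 m _ cubic by (rule power_tendsto_gaussian) (use Re_gam in \<open>auto simp: \<gamma>_def\<close>)
      have "(\<lambda>n. m + y / sqrt (real (Suc n))) \<longlonglongrightarrow> m" by real_asymp
      hence "eventually (\<lambda>n. m + y / sqrt (real (Suc n)) > 0) sequentially"
        using m by (rule order_tendstoD)
      hence "eventually (\<lambda>n. \<Psi> (y / sqrt (real (Suc n))) ^ Suc n = J n y) sequentially"
        by eventually_elim (simp add: J_def)
      with lim show "(\<lambda>n. J n y) \<longlonglongrightarrow> exp (- \<gamma> * of_real (y\<^sup>2 / 2))"
        by (rule Lim_transform_eventually)
    qed
    show "AE y in lborel. norm (J n y) \<le> exp (- (2 * \<delta>) * (y\<^sup>2 / 2))" for n
    proof (rule AE_I2)
      fix y :: real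
      define w where "w = y / sqrt (real (Suc n))"
      show "norm (J n y) \<le> exp (- (2 * \<delta>) * (y\<^sup>2 / 2))"
      proof (cases "m + w > 0")
        case True
        have "norm (J n y) = norm (\<Psi> w) ^ Suc n"
          using True by (simp add: J_def w_def norm_power norm_mult)
        also have "\<dots> \<le> exp (- \<delta> * w\<^sup>2) ^ Suc n"
          using True \<Psi>_bound[of w] by (intro power_mono) auto
        also have "\<dots> = exp (- (2 * \<delta>) * (y\<^sup>2 / 2))"
          unfolding exp_of_nat_mult[symmetric] by (simp add: w_def power_divide del: of_nat_Suc)
        finally show ?thesis .
      qed (simp add: J_def w_def)
    qed
  qed (auto simp: J_def intro!: borel_measurable_continuous_onI continuous_intros)
  have \<rho>: "\<rho> > 0" unfolding \<rho>_def by simp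
  have "(\<lambda>n. norm (cw_Z \<beta> (Suc n)) / \<rho> ^ Suc n) = (\<lambda>n. 2 / norm (gauss_int \<beta>) * norm (LBINT y. J n y))"
    unfolding Z_eq norm_mult norm_power norm_divide norm_B using \<rho> by (simp add: field_simps)
  also have "\<dots> \<longlonglongrightarrow> 2 / norm (gauss_int \<beta>) * norm (gauss_int \<gamma>)"
    by (intro tendsto_intros J_lim)
  finally show "(\<lambda>N. norm (cw_Z \<beta> N) / (exp (- Re \<beta> * (m\<^sup>2 / 2)) * cosh (Re \<beta> * m)) ^ N)
     \<longlonglongrightarrow> 2 * norm (gauss_int (\<beta> * (1 - \<beta> * of_real (1 - m\<^sup>2)))) / norm (gauss_int \<beta>)"
    unfolding \<rho>_def \<gamma>_def by (subst filterlim_sequentially_Suc[symmetric]) simp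
qed

lemma cw_Z_of_real_positive:
  shows "cw_Z (complex_of_real b) N = complex_of_real (norm (cw_Z (complex_of_real b) N))"
    and "cw_Z (complex_of_real b) N \<noteq> 0"
proof -
  define r where "r = (1 / 2 ^ N) * (\<Sum>\<sigma>\<in>spin_configs N. exp (- b * cw_energy N \<sigma>))"
  have eq: "cw_Z (complex_of_real b) N = complex_of_real r"
    by (simp add: cw_Z_def r_def exp_of_real[symmetric])
  have "finite (spin_configs N)" "spin_configs N \<noteq> {}"
    unfolding spin_configs_def by (auto intro!: finite_PiE simp: PiE_eq_empty_iff)
  hence "r > 0" unfolding r_def by (intro mult_pos_pos sum_pos) auto
  thus "cw_Z (complex_of_real b) N = complex_of_real (norm (cw_Z (complex_of_real b) N))"
       "cw_Z (complex_of_real b) N \<noteq> 0" unfolding eq by simp_all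
qed

theorem theorem1p2:
  fixes \<beta> :: complex and \<epsilon> R :: real
  assumes "\<beta> = 1 + complex_of_real \<epsilon> + \<i> * complex_of_real R"
    and "pi < R"
    and "1 + \<epsilon> = R / (2 * pi) * ln ((1 + pi / R) / (1 - pi / R))"
  shows "(\<exists>A :: real. A > 0 \<and> (\<exists>\<delta> :: nat \<Rightarrow> real. \<delta> \<longlonglongrightarrow> 0 \<and>
            (\<forall>N\<ge>1. complex_of_real (cmod (cw_Z \<beta> N)) =
               cw_Z (complex_of_real (Re \<beta>)) N * complex_of_real A * complex_of_real (1 + \<delta> N))))
       \<and> (\<exists>L :: real. (\<lambda>N. 1 / real N * ln (cmod (cw_Z \<beta> N))) \<longlonglongrightarrow> L \<and> L > 0)"
proof -
  define m where "m = pi / R"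
  define b where "b = Re \<beta>"
  have Re: "b = 1 + \<epsilon>" and Im: "Im \<beta> = R" using assms(1) by (simp_all add: b_def)
  have R: "R > 0" using assms(2) pi_gt_zero by linarith
  have m: "0 < m" "m < 1" using assms(2) R by (auto simp: m_def)
  have bm2: "2 * (b * m) = ln ((1 + m) / (1 - m))"
    using assms(2,3) pi_gt_zero by (simp add: Re m_def field_simps)
  have "ln ((1 + m) / (1 - m)) > 0" using m by (simp add: divide_simps)
  hence b: "b > 0" using m bm2 by (metis mult_pos_pos zero_less_mult_pos2 zero_less_numeral zero_less_mult_pos)
  have fp: "tanh (b * m) = m"
  proof -
    have "exp (- 2 * (b * m)) = (1 - m) / (1 + m)"
      using bm2 m by (simp add: exp_minus)
    thus ?thesis unfolding tanh_real_altdef using m by (simp only:) (simp add: divide_simps)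
  qed
  have "Im \<beta> * m = pi" using R by (simp add: Im m_def)
  hence sin: "sin (Im \<beta> * m) = 0" by simp
  define \<rho> where "\<rho> = exp (- b * (m\<^sup>2 / 2)) * cosh (b * m)"
  have \<rho>: "\<rho> > 1"
  proof -
    \<comment> \<open>Comparison of the value at \<open>w = - m\<close>, the point \<open>z = 0\<close>, with the maximum at \<open>z = m\<close>.\<close>
    obtain \<delta> where "\<delta> > 0" and
      h: "exp (- b * (m * (- m) + (- m)\<^sup>2 / 2)) * (cosh (b * (m + - m)) / cosh (b * m)) \<le> exp (- \<delta> * (- m)\<^sup>2)"
      using cosh_gaussian_bound[OF b m(1) fp] by blast
    have "- b * (m * (- m) + (- m)\<^sup>2 / 2) = b * (m\<^sup>2 / 2)"
      by (simp add: power2_eq_square field_simps)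
    from h[unfolded this] have "exp (b * (m\<^sup>2 / 2)) / cosh (b * m) \<le> exp (- \<delta> * m\<^sup>2)" by simp
    also have "\<dots> < 1" using \<open>\<delta> > 0\<close> m by simp
    finally show ?thesis by (simp add: \<rho>_def exp_minus divide_simps)
  qed
  \<comment> \<open>\<open>m\<close> and \<open>\<rho>\<close> depend only on \<open>b\<close>, so the asymptotics at \<open>\<beta>\<close> and at \<open>b\<close> share the exponential factor.\<close>
  define G where "G = (\<lambda>\<beta>. 2 * norm (gauss_int (\<beta> * (1 - \<beta> * of_real (1 - m\<^sup>2)))) / norm (gauss_int \<beta>))"
  have lim: "(\<lambda>N. norm (cw_Z \<beta> N) / \<rho> ^ N) \<longlonglongrightarrow> G \<beta>" and G: "G \<beta> > 0"
    using cw_Z_asymptotics[of \<beta> m] gauss_int_nonzero b m fp sin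
    by (auto simp: \<rho>_def G_def b_def)
  have lim_b: "(\<lambda>N. norm (cw_Z (of_real b) N) / \<rho> ^ N) \<longlonglongrightarrow> G (of_real b)" and G_b: "G (of_real b) > 0"
    using cw_Z_asymptotics[of "of_real b" m] gauss_int_nonzero[of "of_real b"]
      gauss_int_nonzero[of "of_real b * (1 - of_real b * of_real (1 - m\<^sup>2))"] b m fp
    by (auto simp: \<rho>_def G_def)
  define A where "A = G \<beta> / G (of_real b)"
  define \<delta> where "\<delta> = (\<lambda>N. norm (cw_Z \<beta> N) / norm (cw_Z (of_real b) N) / A - 1)"
  have A: "A > 0" using G G_b by (simp add: A_def)
  have "(\<lambda>N. (norm (cw_Z \<beta> N) / \<rho> ^ N) / (norm (cw_Z (of_real b) N) / \<rho> ^ N) / A - 1) \<longlonglongrightarrow> A / A - 1"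
    using A G_b unfolding A_def by (intro tendsto_intros lim lim_b) auto
  hence "\<delta> \<longlonglongrightarrow> 0" using A \<rho> by (simp add: \<delta>_def)
  moreover have "complex_of_real (cmod (cw_Z \<beta> N)) =
      cw_Z (complex_of_real b) N * complex_of_real A * complex_of_real (1 + \<delta> N)" for N
  proof -
    have "cmod (cw_Z \<beta> N) = norm (cw_Z (complex_of_real b) N) * A * (1 + \<delta> N)"
      using A cw_Z_of_real_positive(2)[of b N] by (simp add: \<delta>_def)
    thus ?thesis by (metis cw_Z_of_real_positive(1) of_real_mult)
  qed
  ultimately have part1: "\<exists>A :: real. A > 0 \<and> (\<exists>\<delta> :: nat \<Rightarrow> real. \<delta> \<longlonglongrightarrow> 0 \<and>
            (\<forall>N\<ge>1. complex_of_real (cmod (cw_Z \<beta> N)) =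
               cw_Z (complex_of_real (Re \<beta>)) N * complex_of_real A * complex_of_real (1 + \<delta> N)))"
    using A unfolding b_def by blast
  have "(\<lambda>N. 1 / real N * ln (norm (cw_Z \<beta> N) / \<rho> ^ N) + ln \<rho>) \<longlonglongrightarrow> 0 * ln (G \<beta>) + ln \<rho>"
    using G by (intro tendsto_intros lim lim_1_over_n) auto
  moreover have "eventually (\<lambda>N. 1 / real N * ln (norm (cw_Z \<beta> N) / \<rho> ^ N) + ln \<rho>
      = 1 / real N * ln (cmod (cw_Z \<beta> N))) sequentially"
    using order_tendstoD(1)[OF lim G] eventually_gt_at_top[of 0]
  proof eventually_elim
    case (elim N)
    hence "cmod (cw_Z \<beta> N) > 0" using \<rho> by (simp add: zero_less_divide_iff)
    thus ?case using elim \<rho> by (simp add: ln_div ln_realpow field_simps)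
  qed
  ultimately have "(\<lambda>N. 1 / real N * ln (cmod (cw_Z \<beta> N))) \<longlonglongrightarrow> 0 * ln (G \<beta>) + ln \<rho>"
    by (rule Lim_transform_eventually)
  with part1 \<rho> show ?thesis by auto
qed

end
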